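(* Let $\{X_k(p_0,p_1,p_2,p_3)\}$ be the fourth-order linear recurrence sequence defined by $X_{k+4}=p_0X_{k+3}+p_1X_{k+2}+p_2X_{k+1}+p_3X_k$ with the initial values $X_0=0$, $X_1=0$, $X_2=0$, $X_3=1$. The following algorithm takes as input $p_0,p_1,p_2,p_3$ and $N=\sum_{i=0}^{m-1}b_i2^i$ (binary expansion, with $b_{m-1}=1$) and outputs $X_N$, $X_{N+1}$, $X_{N+2}$, $X_{N+3}$. For a quadruple $(x_1,x_2,x_3,x_4)$ put $$\begin{aligned} F_0&=x_2(2x_3-p_0x_2)+x_1(2x_4-2p_0x_3-2p_1x_2-p_2x_1),\\ F_1&=x_3^2+x_2(2x_4-2p_0x_3-p_1x_2)+p_3x_1^2,\\ F_2&=x_3(2x_4-p_0x_3)+x_2(p_2x_2+2p_3x_1),\\ F_3&=x_4^2+x_3(p_1x_3+2p_2x_2+2p_3x_1)+p_3x_2^2,\\ F_4&=x_4(p_0x_4+2p_1x_3+2p_2x_2+2p_3x_1)+x_3(p_2x_3+2p_3x_2). \end{aligned}$$ Start with $(x_1,x_2,x_3,x_4)=(0,0,1,p_0)$. For $j$ from $m-2$ down to $0$ by steps of $-1$, replace $(x_1,x_2,x_3,x_4)$ by $(F_1,F_2,F_3,F_4)$ if $b_j=1$, and by $(F_0,F_1,F_2,F_3)$ otherwise (all $F_i$ being evaluated at the old quadruple). Finally return $(x_1,x_2,x_3,x_4)$, which is $(X_N,X_{N+1},X_{N+2},X_{N+3})$. Counting only "big" multiplications, one needs $6m$ multiplications and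 $4m$ squarings to compute the terms $X_N,X_{N+1},X_{N+2},X_{N+3}$.
   Context: Here $m$ is the number of binary digits of $N$. Only "big" multiplications are counted: multiplications by $p_0,p_1,p_2,p_3$ are regarded as simulated by additions and are not counted. Each product of the form $x_i(\cdots)$ in the displayed formulas is a multiplication and each $x_i^2$ is a squaring.
   Formalization: The loop runs m-1 times, so the exact totals are 6(m-1) multiplications and 4(m-1) squarings (none for N=1); these exact counts are proved, and 6m and 4m are proved as upper bounds. *)

theory Defs
  imports Main
begin

fun X :: "'a::comm_ring_1 \<Rightarrow> 'a \<Rightarrow> 'a \<Rightarrow> 'a \<Rightarrow> nat \<Rightarrow> 'a" where
  "X p0 p1 p2 p3 0 = 0"
| "X p0 p1 p2 p3 (Suc 0) = 0"
| "X p0 p1 p2 p3 (Suc (Suc 0)) = 0"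
| "X p0 p1 p2 p3 (Suc (Suc (Suc 0))) = 1"
| "X p0 p1 p2 p3 (Suc (Suc (Suc (Suc k)))) =
     p0 * X p0 p1 p2 p3 (Suc (Suc (Suc k))) + p1 * X p0 p1 p2 p3 (Suc (Suc k))
     + p2 * X p0 p1 p2 p3 (Suc k) + p3 * X p0 p1 p2 p3 k"

type_synonym 'a quad = "'a \<times> 'a \<times> 'a \<times> 'a"

text \<open>The formulas are represented syntactically, so that the operation counts are read off the
  formulas themselves. Only \<open>Mul\<close> and \<open>Sq\<close> are big operations. Doubling and multiplication by
  one of the parameters (\<open>Dbl\<close>, \<open>Par\<close>) are simulated by additions and cost nothing.\<close>

datatype param = P0 | P1 | P2 | P3

datatype expr =
    x1 | x2 | x3 | x4
  | Add expr expr (infixl "\<oplus>" 65)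
  | Sub expr expr (infixl "\<ominus>" 65)
  | Dbl expr
  | Par param expr (infixr "\<cdot>" 75)
  | Mul expr expr (infixl "\<otimes>" 70)
  | Sq expr

fun param_val :: "'a quad \<Rightarrow> param \<Rightarrow> 'a" where
  "param_val (p0, p1, p2, p3) P0 = p0"
| "param_val (p0, p1, p2, p3) P1 = p1"
| "param_val (p0, p1, p2, p3) P2 = p2"
| "param_val (p0, p1, p2, p3) P3 = p3"

fun val :: "'a::comm_ring_1 quad \<Rightarrow> 'a quad \<Rightarrow> expr \<Rightarrow> 'a" where
  "val p (a, b, c, d) x1 = a"
| "val p (a, b, c, d) x2 = b"
| "val p (a, b, c, d) x3 = c"
| "val p (a, b, c, d) x4 = d"
| "val p x (e \<oplus> f) = val p x e + val p x f"
| "val p x (e \<ominus> f) = val p x e - val p x f"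
| "val p x (Dbl e) = 2 * val p x e"
| "val p x (q \<cdot> e) = param_val p q * val p x e"
| "val p x (e \<otimes> f) = val p x e * val p x f"
| "val p x (Sq e) = (val p x e)^2"

fun num_mults :: "expr \<Rightarrow> nat" where
  "num_mults (e \<oplus> f) = num_mults e + num_mults f"
| "num_mults (e \<ominus> f) = num_mults e + num_mults f"
| "num_mults (Dbl e) = num_mults e"
| "num_mults (q \<cdot> e) = num_mults e"
| "num_mults (e \<otimes> f) = num_mults e + num_mults f + 1"
| "num_mults (Sq e) = num_mults e"
| "num_mults _ = 0"

fun num_squares :: "expr \<Rightarrow> nat" where
  "num_squares (e \<oplus> f) = num_squares e + num_squares f"
| "num_squares (e \<ominus> f) = num_squares e + num_squares f"
| "num_squares (Dbl e) = num_squares e"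
| "num_squares (q \<cdot> e) = num_squares e"
| "num_squares (e \<otimes> f) = num_squares e + num_squares f"
| "num_squares (Sq e) = num_squares e + 1"
| "num_squares _ = 0"

definition F0 :: expr where
  "F0 = x2 \<otimes> (Dbl x3 \<ominus> P0 \<cdot> x2)
      \<oplus> x1 \<otimes> (Dbl x4 \<ominus> Dbl (P0 \<cdot> x3) \<ominus> Dbl (P1 \<cdot> x2) \<ominus> P2 \<cdot> x1)"

definition F1 :: expr where
  "F1 = Sq x3 \<oplus> x2 \<otimes> (Dbl x4 \<ominus> Dbl (P0 \<cdot> x3) \<ominus> P1 \<cdot> x2) \<oplus> P3 \<cdot> Sq x1"

definition F2 :: expr where
  "F2 = x3 \<otimes> (Dbl x4 \<ominus> P0 \<cdot> x3) \<oplus> x2 \<otimes> (P2 \<cdot> x2 \<oplus> Dbl (P3 \<cdot> x1))"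

definition F3 :: expr where
  "F3 = Sq x4 \<oplus> x3 \<otimes> (P1 \<cdot> x3 \<oplus> Dbl (P2 \<cdot> x2) \<oplus> Dbl (P3 \<cdot> x1)) \<oplus> P3 \<cdot> Sq x2"

definition F4 :: expr where
  "F4 = x4 \<otimes> (P0 \<cdot> x4 \<oplus> Dbl (P1 \<cdot> x3) \<oplus> Dbl (P2 \<cdot> x2) \<oplus> Dbl (P3 \<cdot> x1))
      \<oplus> x3 \<otimes> (P2 \<cdot> x3 \<oplus> Dbl (P3 \<cdot> x2))"

record 'a state =
  quad :: "'a quad"
  mults :: nat
  squares :: nat

fun assign :: "'a::comm_ring_1 quad \<Rightarrow> expr \<times> expr \<times> expr \<times> expr \<Rightarrow> 'a state \<Rightarrow> 'a state" where
  "assign p (e1, e2, e3, e4) s =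
     \<lparr>quad = (val p (quad s) e1, val p (quad s) e2, val p (quad s) e3, val p (quad s) e4),
      mults = mults s + (num_mults e1 + num_mults e2 + num_mults e3 + num_mults e4),
      squares = squares s + (num_squares e1 + num_squares e2 + num_squares e3 + num_squares e4)\<rparr>"

definition step :: "'a::comm_ring_1 quad \<Rightarrow> nat \<Rightarrow> 'a state \<Rightarrow> 'a state" where
  "step p d = assign p (if d = 1 then (F1, F2, F3, F4) else (F0, F1, F2, F3))"

text \<open>The list \<open>rev [0..<m - 1]\<close> is \<open>[m - 2, \<dots>, 1, 0]\<close>.\<close>

definition algorithm ::
    "'a::comm_ring_1 \<Rightarrow> 'a \<Rightarrow> 'a \<Rightarrow> 'a \<Rightarrow> nat \<Rightarrow> (nat \<Rightarrow> nat) \<Rightarrow> 'a state" where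
  "algorithm p0 p1 p2 p3 m b =
     fold (\<lambda>j. step (p0, p1, p2, p3) (b j)) (rev [0..<m - 1])
       \<lparr>quad = (0, 0, 1, p0), mults = 0, squares = 0\<rparr>"

end

(* The recurrence gives an addition formula expressing X (n + k) bilinearly in the windows
   X n, ..., X (n + 3) and X k, ..., X (k + 3). At k = n, ..., n + 4 it becomes the duplication
   formulas F0, ..., F4, so a loop step maps the window at n to the window at 2 n + b_j, and the
   loop is Horner's scheme for the binary expansion of N. *)

theory Submission imports Defs begin

lemma X_rec:
  "X p0 p1 p2 p3 (k + 4) = p0 * X p0 p1 p2 p3 (k + 3) + p1 * X p0 p1 p2 p3 (k + 2)
     + p2 * X p0 p1 p2 p3 (k + 1) + p3 * X p0 p1 p2 p3 k"
  by (simp add: numeral_eq_Suc)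

text \<open>Induction on \<open>k\<close> moves one unit of index from \<open>k\<close> to
  \<open>n\<close>, so \<open>n\<close> must stay general. At \<open>k = 0\<close> the initial
  values leave only the term \<open>Y n * Y 3\<close>.\<close>

lemma X_add:
  fixes p0 p1 p2 p3 :: "'a::comm_ring_1"
  defines "Y \<equiv> X p0 p1 p2 p3"
  shows "Y (n + k) = Y (n + 3) * Y k + Y (n + 2) * (Y (k + 1) - p0 * Y k)
    + Y (n + 1) * (Y (k + 2) - p0 * Y (k + 1) - p1 * Y k)
    + Y n * (Y (k + 3) - p0 * Y (k + 2) - p1 * Y (k + 1) - p2 * Y k)"
proof (induction k arbitrary: n)
  case 0
  show ?case
    by (simp add: Y_def numeral_eq_Suc)
next
  case (Suc k)
  have rec: "Y (i + 4) = p0 * Y (i + 3) + p1 * Y (i + 2) + p2 * Y (i + 1) + p3 * Y i" for i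
    unfolding Y_def by (rule X_rec)
  have "Y (n + Suc k) = Y (Suc n + k)"
    by simp
  also have "\<dots> = Y (n + 4) * Y k + Y (n + 3) * (Y (k + 1) - p0 * Y k)
    + Y (n + 2) * (Y (k + 2) - p0 * Y (k + 1) - p1 * Y k)
    + Y (n + 1) * (Y (k + 3) - p0 * Y (k + 2) - p1 * Y (k + 1) - p2 * Y k)"
    using Suc.IH[of "Suc n"] by (simp add: numeral_eq_Suc)
  \<comment> \<open>Expanding \<open>Y (n + 4)\<close> cancels one correction term in each bracket
    and adds \<open>p3 * Y n * Y k\<close>. By the recurrence at \<open>k\<close>, the last bracket
    here equals \<open>p3 * Y k\<close>.\<close>
  also have "\<dots> = Y (n + 3) * Y (k + 1) + Y (n + 2) * (Y (k + 2) - p0 * Y (k + 1))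
    + Y (n + 1) * (Y (k + 3) - p0 * Y (k + 2) - p1 * Y (k + 1))
    + Y n * (Y (k + 4) - p0 * Y (k + 3) - p1 * Y (k + 2) - p2 * Y (k + 1))"
    unfolding rec by (simp only: algebra_simps)
  finally show ?case
    by (simp add: numeral_eq_Suc)
qed

definition window :: "'a::comm_ring_1 \<Rightarrow> 'a \<Rightarrow> 'a \<Rightarrow> 'a \<Rightarrow> nat \<Rightarrow> 'a quad" where
  "window p0 p1 p2 p3 n =
     (X p0 p1 p2 p3 n, X p0 p1 p2 p3 (n + 1), X p0 p1 p2 p3 (n + 2), X p0 p1 p2 p3 (n + 3))"

lemma duplication:
  fixes p0 p1 p2 p3 :: "'a::comm_ring_1"
  defines "Y \<equiv> X p0 p1 p2 p3" and "v \<equiv> \<lambda>n. val (p0, p1, p2, p3) (window p0 p1 p2 p3 n)"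
  shows "v n F0 = Y (2 * n)" "v n F1 = Y (2 * n + 1)" "v n F2 = Y (2 * n + 2)"
    "v n F3 = Y (2 * n + 3)" "v n F4 = Y (2 * n + 4)"
proof -
  \<comment> \<open>The successor form matches the indices that simplification produces; it brings
    every index above \<open>n + 3\<close> back into the window.\<close>
  have rec: "Y (Suc (Suc (Suc (Suc i)))) = p0 * Y (Suc (Suc (Suc i))) + p1 * Y (Suc (Suc i))
      + p2 * Y (Suc i) + p3 * Y i" for i
    unfolding Y_def by simp
  have add: "Y (2 * n + i) = Y (n + 3) * Y (n + i) + Y (n + 2) * (Y (n + i + 1) - p0 * Y (n + i))
      + Y (n + 1) * (Y (n + i + 2) - p0 * Y (n + i + 1) - p1 * Y (n + i))
      + Y n * (Y (n + i + 3) - p0 * Y (n + i + 2) - p1 * Y (n + i + 1) - p2 * Y (n + i))" for i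
    using X_add[of p0 p1 p2 p3 n "n + i", folded Y_def] by (simp only: mult_2 add.assoc)
  have v: "v n e = val (p0, p1, p2, p3) (Y n, Y (n + 1), Y (n + 2), Y (n + 3)) e" for e
    by (simp add: v_def window_def Y_def)
  show "v n F0 = Y (2 * n)"
    unfolding v add[of 0, simplified]
    by (simp add: F0_def numeral_3_eq_3 algebra_simps)
  show "v n F1 = Y (2 * n + 1)"
    unfolding v add
    by (simp add: F1_def power2_eq_square numeral_3_eq_3 rec) (simp add: algebra_simps)
  show "v n F2 = Y (2 * n + 2)"
    unfolding v add
    by (simp add: F2_def power2_eq_square numeral_3_eq_3 rec) (simp add: algebra_simps)
  show "v n F3 = Y (2 * n + 3)"
    unfolding v add
    by (simp add: F3_def power2_eq_square numeral_3_eq_3 rec) (simp add: algebra_simps)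
  show "v n F4 = Y (2 * n + 4)"
    unfolding v add
    by (simp add: F4_def power2_eq_square numeral_3_eq_3 eval_nat_numeral rec)
      (simp add: algebra_simps)
qed

text \<open>The digit \<open>d\<close> selects four consecutive duplication formulas, starting at
  index \<open>2 * n\<close> or \<open>2 * n + 1\<close>.\<close>

lemma quad_step:
  assumes "d \<in> {0, 1}" and "quad s = window p0 p1 p2 p3 n"
  shows "quad (step (p0, p1, p2, p3) d s) = window p0 p1 p2 p3 (d + 2 * n)"
  using assms by (auto simp: step_def duplication) (simp_all add: window_def numeral_eq_Suc)

text \<open>\<open>F0\<close>, \<open>F2\<close>, \<open>F4\<close> cost two multiplications each;
  \<open>F1\<close> and \<open>F3\<close> cost one multiplication and two squarings each. Both
  choices of four formulas therefore cost the same.\<close>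

lemma mults_step: "mults (step p d s) = mults s + 6"
  by (simp add: step_def F0_def F1_def F2_def F3_def F4_def)

lemma squares_step: "squares (step p d s) = squares s + 4"
  by (simp add: step_def F0_def F1_def F2_def F3_def F4_def)

text \<open>The final pass \<open>j = 0\<close> is split off; the earlier passes form the loop for
  the digits shifted down by one. For \<open>m = 0\<close> the loop on the left would be empty, with
  no pass to split off.\<close>

lemma algorithm_Suc:
  assumes "m \<ge> 1"
  shows "algorithm p0 p1 p2 p3 (Suc m) b =
    step (p0, p1, p2, p3) (b 0) (algorithm p0 p1 p2 p3 m (\<lambda>i. b (Suc i)))"
proof -
  obtain k where m: "m = Suc k"
    using assms by (cases m) auto
  have "rev [0..<Suc k] = map Suc (rev [0..<k]) @ [0]"
    by (simp add: upt_conv_Cons map_Suc_upt del: upt_Suc flip: rev_map)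
  then show ?thesis
    unfolding algorithm_def m by (simp add: fold_map comp_def del: upt_Suc)
qed

lemma algorithm_correct:
  assumes "m \<ge> 1" and "\<And>i. i < m \<Longrightarrow> b i \<in> {0, 1}" and "b (m - 1) = 1"
  shows "quad (algorithm p0 p1 p2 p3 m b) = window p0 p1 p2 p3 (\<Sum>i<m. b i * 2 ^ i)"
  using assms
proof (induction m arbitrary: b rule: nat_induct_at_least)
  case base
  then show ?case
    \<comment> \<open>The single digit is the leading 1, and the initial quadruple is the window at
      index 1.\<close>
    by (simp add: algorithm_def window_def numeral_eq_Suc)
next
  case (Suc m)
  let ?c = "\<lambda>i. b (Suc i)"
  have bits: "?c i \<in> {0, 1}" if "i < m" for i
    using Suc.prems(1) that by simp
  have top: "?c (m - 1) = 1"
    using Suc.prems(2) Suc.hyps by simp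
  \<comment> \<open>This is one Horner step, in the shape \<open>d + 2 * n\<close> required by
    \<open>quad_step\<close>.\<close>
  have sum: "(\<Sum>i<Suc m. b i * 2 ^ i) = b 0 + 2 * (\<Sum>i<m. ?c i * 2 ^ i)"
    by (simp add: sum.lessThan_Suc_shift sum_distrib_left mult_ac del: sum.lessThan_Suc)
  show ?case
    unfolding algorithm_Suc[OF Suc.hyps] sum
    using Suc.prems(1)[of 0] Suc.IH[of ?c, OF bits top] by (intro quad_step) simp_all
qed

text \<open>The leading digit is absorbed by the initial quadruple, so only \<open>m - 1\<close>
  passes are charged.\<close>

lemma algorithm_cost:
  assumes "m \<ge> 1"
  shows "mults (algorithm p0 p1 p2 p3 m b) = 6 * (m - 1)"
    and "squares (algorithm p0 p1 p2 p3 m b) = 4 * (m - 1)"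
  using assms
proof (induction m arbitrary: b rule: nat_induct_at_least)
  case base
  case 1 show ?case by (simp add: algorithm_def)
  case 2 show ?case by (simp add: algorithm_def)
next
  case (Suc m)
  case 1 show ?case
    using Suc.hyps by (simp add: algorithm_Suc mults_step Suc.IH)
  case 2 show ?case
    using Suc.hyps by (simp add: algorithm_Suc squares_step Suc.IH)
qed

theorem mainTheorem2:
  fixes p0 p1 p2 p3 :: "'a::comm_ring_1"
    and N m :: nat and b :: "nat \<Rightarrow> nat"
  assumes "m \<ge> 1"
    and "\<And>i. i < m \<Longrightarrow> b i \<in> {0, 1}"
    and "b (m - 1) = 1"
    and "N = (\<Sum>i<m. b i * 2 ^ i)"
  shows "quad (algorithm p0 p1 p2 p3 m b) =
           (X p0 p1 p2 p3 N, X p0 p1 p2 p3 (N + 1), X p0 p1 p2 p3 (N + 2), X p0 p1 p2 p3 (N + 3))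
       \<and> mults (algorithm p0 p1 p2 p3 m b) = 6 * (m - 1)
       \<and> squares (algorithm p0 p1 p2 p3 m b) = 4 * (m - 1)
       \<and> mults (algorithm p0 p1 p2 p3 m b) \<le> 6 * m
       \<and> squares (algorithm p0 p1 p2 p3 m b) \<le> 4 * m"
  using algorithm_correct[of m b p0 p1 p2 p3, OF assms(1-3)] algorithm_cost[OF assms(1), of p0 p1 p2 p3 b]
  by (simp add: window_def assms(4))

end
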